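(* Let $n\ge 2$ be an integer and let $Q_{4n}=\langle a,b : a^{2n}=1,\ a^n=b^2,\ bab^{-1}=a^{-1}\rangle$ be the generalized quaternion group. Then each of the graphs $\Gamma=\mathrm{ESCom}(Q_{4n})$, $\Gamma=\mathrm{CSCom}(Q_{4n})$ and $\Gamma=\mathrm{OSCom}(Q_{4n})$ satisfies the Hansen--Vukičević inequality \[ \frac{M_2(\Gamma)}{|e(\Gamma)|}\ \ge\ \frac{M_1(\Gamma)}{|v(\Gamma)|}. \]
   Context: For an equivalence relation $B$ on a finite group $G$, with $[g]$ the class of $g$, the $B$ super commuting graph of $G$ is the simple graph with vertex set $G$ in which two distinct vertices $g,h$ are adjacent if and only if $[g]=[h]$ or there exist $g'\in[g]$, $h'\in[h]$ with $g'h'=h'g'$. It is denoted $\mathrm{ESCom}(G)$ when $B$ is equality (so $g\ne h$ are adjacent iff $gh=hg$), $\mathrm{CSCom}(G)$ when $B$ is conjugacy in $G$, and $\mathrm{OSCom}(G)$ when $B$ is the relation of having the same order. For a finite simple graph $\Gamma$ with vertex set $v(\Gamma)$ and edge set $e(\Gamma)$, the first and second Zagreb indices are $M_1(\Gamma)=\sum_{v\in v(\Gamma)}\deg(v)^2$ and $M_2(\Gamma)=\sum_{uv\in e(\Gamma)}\deg(u)\deg(v)$. *)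

theory Defs
  imports "HOL-Algebra.Algebra"
begin

section \<open>Groups given by generators and relations\<close>

datatype 'x letter = Gen 'x | Inv 'x

text \<open>The least congruence on the free monoid of words in the generators and their formal
  inverses that cancels formal inverses and identifies \<open>u\<close> with \<open>v\<close> for every relation
  \<open>u = v\<close>, the latter being the pair \<open>(u, v) \<in> R\<close>.\<close>

inductive_set word_cong :: "('x letter list \<times> 'x letter list) set \<Rightarrow> ('x letter list \<times> 'x letter list) set"
  for R where
  refl: "(u, u) \<in> word_cong R"
| sym: "(u, v) \<in> word_cong R \<Longrightarrow> (v, u) \<in> word_cong R"
| trans: "(u, v) \<in> word_cong R \<Longrightarrow> (v, w) \<in> word_cong R \<Longrightarrow> (u, w) \<in> word_cong R"
| append: "(u, u') \<in> word_cong R \<Longrightarrow> (v, v') \<in> word_cong R \<Longrightarrow> (u @ v, u' @ v') \<in> word_cong R"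
| cancel_right: "([Gen x, Inv x], []) \<in> word_cong R"
| cancel_left: "([Inv x, Gen x], []) \<in> word_cong R"
| relation: "(u, v) \<in> R \<Longrightarrow> (u, v) \<in> word_cong R"

definition presented_group ::
  "('x letter list \<times> 'x letter list) set \<Rightarrow> 'x letter list set monoid" where
  "presented_group R =
    \<lparr>carrier = UNIV // word_cong R,
     monoid.mult = (\<lambda>U V. \<Union>u\<in>U. \<Union>v\<in>V. word_cong R `` {u @ v}),
     monoid.one = word_cong R `` {[]}\<rparr>"

lemma equiv_word_cong: "equiv UNIV (word_cong R)"
  by (intro equivI refl_onI symI transI) (auto intro: word_cong.intros)

lemma presented_group_mult:
  "word_cong R `` {u} \<otimes>\<^bsub>presented_group R\<^esub> word_cong R `` {v} = word_cong R `` {u @ v}"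
proof -
  have "word_cong R `` {u' @ v'} = word_cong R `` {u @ v}"
    if "(u, u') \<in> word_cong R" "(v, v') \<in> word_cong R" for u' v'
    using that by (metis equiv_class_eq equiv_word_cong word_cong.append)
  then have "(\<Union>u'\<in>word_cong R `` {u}. \<Union>v'\<in>word_cong R `` {v}. word_cong R `` {u' @ v'})
      = (\<Union>u'\<in>word_cong R `` {u}. \<Union>v'\<in>word_cong R `` {v}. word_cong R `` {u @ v})"
    by (intro SUP_cong HOL.refl) blast
  also have "\<dots> = word_cong R `` {u @ v}"
    using word_cong.refl[of u R] word_cong.refl[of v R] by blast
  finally show ?thesis by (simp add: presented_group_def)
qed

lemma word_cong_left_inverse: "\<exists>v. (v @ u, []) \<in> word_cong R"
proof (induction u)
  case Nil
  show ?case by (auto intro: word_cong.refl)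
next
  case (Cons l u)
  then obtain v where v: "(v @ u, []) \<in> word_cong R" by blast
  obtain l' where l': "([l', l], []) \<in> word_cong R"
    by (cases l) (auto intro: word_cong.cancel_left word_cong.cancel_right)
  have "(v @ ([l', l] @ u), v @ ([] @ u)) \<in> word_cong R"
    by (intro word_cong.append l' word_cong.refl)
  then have "((v @ [l']) @ (l # u), []) \<in> word_cong R"
    using v by (auto intro: word_cong.trans)
  then show ?case by blast
qed

lemma group_presented_group: "group (presented_group R)"
proof -
  have carrier: "x \<in> carrier (presented_group R) \<longleftrightarrow> (\<exists>u. x = word_cong R `` {u})" for x
    by (auto simp: presented_group_def quotient_def)
  have one: "\<one>\<^bsub>presented_group R\<^esub> = word_cong R `` {[]}"
    by (simp add: presented_group_def)
  show ?thesis
  proof (rule groupI)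
    fix x assume "x \<in> carrier (presented_group R)"
    then obtain u where u: "x = word_cong R `` {u}" by (auto simp: carrier)
    obtain v where "(v @ u, []) \<in> word_cong R" using word_cong_left_inverse by blast
    then have "word_cong R `` {v @ u} = word_cong R `` {[]}"
      using equiv_class_eq[OF equiv_word_cong] by blast
    then show "\<exists>y\<in>carrier (presented_group R).
        y \<otimes>\<^bsub>presented_group R\<^esub> x = \<one>\<^bsub>presented_group R\<^esub>"
      by (intro bexI[of _ "word_cong R `` {v}"]) (auto simp: u carrier one presented_group_mult)
  qed (auto simp: carrier one presented_group_mult)
qed


section \<open>The generalized quaternion group of order \<open>4n\<close>\<close>

datatype quaternion_gen = a | b

definition quaternion_relations ::
  "nat \<Rightarrow> (quaternion_gen letter list \<times> quaternion_gen letter list) set" where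
  "quaternion_relations n =
    {(replicate (2 * n) (Gen a), []),
     (replicate n (Gen a), [Gen b, Gen b]),
     ([Gen b, Gen a, Inv b], [Inv a])}"

definition quaternion_group :: "nat \<Rightarrow> quaternion_gen letter list set monoid" where
  "quaternion_group n = presented_group (quaternion_relations n)"

hide_const (open) a b


section \<open>Finite simple graphs and Zagreb indices\<close>

text \<open>Edges are two-element sets of vertices.\<close>

record 'v sgraph =
  verts :: "'v set"
  edges :: "'v set set"

definition vertex_degree :: "'v sgraph \<Rightarrow> 'v \<Rightarrow> nat" where
  "vertex_degree \<Gamma> v = card {e \<in> edges \<Gamma>. v \<in> e}"

definition zagreb1 :: "'v sgraph \<Rightarrow> nat" where
  "zagreb1 \<Gamma> = (\<Sum>v\<in>verts \<Gamma>. (vertex_degree \<Gamma> v)\<^sup>2)"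

text \<open>For an edge \<open>e = {u, v}\<close> with \<open>u \<noteq> v\<close>, the inner product is \<open>vertex_degree \<Gamma> u * vertex_degree \<Gamma> v\<close>.\<close>

definition zagreb2 :: "'v sgraph \<Rightarrow> nat" where
  "zagreb2 \<Gamma> = (\<Sum>e\<in>edges \<Gamma>. \<Prod>v\<in>e. vertex_degree \<Gamma> v)"


section \<open>Super commuting graphs\<close>

text \<open>For an equivalence relation \<open>B\<close> on \<open>carrier G\<close>, the class of \<open>g\<close> is \<open>B `` {g}\<close>.\<close>

definition super_commuting_graph :: "('g, 'm) monoid_scheme \<Rightarrow> ('g \<times> 'g) set \<Rightarrow> 'g sgraph" where
  "super_commuting_graph G B =
    \<lparr>verts = carrier G,
     edges = {{g, h} | g h. g \<in> carrier G \<and> h \<in> carrier G \<and> g \<noteq> h \<and>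
       (B `` {g} = B `` {h} \<or>
        (\<exists>g'\<in>B `` {g}. \<exists>h'\<in>B `` {h}. g' \<otimes>\<^bsub>G\<^esub> h' = h' \<otimes>\<^bsub>G\<^esub> g'))}\<rparr>"

definition conjugacy :: "('g, 'm) monoid_scheme \<Rightarrow> ('g \<times> 'g) set" where
  "conjugacy G = {(g, h). g \<in> carrier G \<and> h \<in> carrier G \<and>
    (\<exists>x\<in>carrier G. h = x \<otimes>\<^bsub>G\<^esub> g \<otimes>\<^bsub>G\<^esub> inv\<^bsub>G\<^esub> x)}"

definition same_order :: "('g, 'm) monoid_scheme \<Rightarrow> ('g \<times> 'g) set" where
  "same_order G = {(g, h). g \<in> carrier G \<and> h \<in> carrier G \<and> group.ord G g = group.ord G h}"

definition ESCom :: "('g, 'm) monoid_scheme \<Rightarrow> 'g sgraph" where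
  "ESCom G = super_commuting_graph G (Id_on (carrier G))"

definition CSCom :: "('g, 'm) monoid_scheme \<Rightarrow> 'g sgraph" where
  "CSCom G = super_commuting_graph G (conjugacy G)"

definition OSCom :: "('g, 'm) monoid_scheme \<Rightarrow> 'g sgraph" where
  "OSCom G = super_commuting_graph G (same_order G)"

lemma equiv_same_order: "equiv (carrier G) (same_order G)"
  by (intro equivI refl_onI symI transI) (auto simp: same_order_def)

lemma (in group) equiv_conjugacy: "equiv (carrier G) (conjugacy G)"
proof (intro equivI refl_onI symI transI)
  show "conjugacy G \<subseteq> carrier G \<times> carrier G" by (auto simp: conjugacy_def)
  show "(g, g) \<in> conjugacy G" if "g \<in> carrier G" for g
    using that by (auto simp: conjugacy_def intro!: bexI[of _ \<one>])
  have conj: "(g, x \<otimes> g \<otimes> inv x) \<in> conjugacy G" if "g \<in> carrier G" "x \<in> carrier G" for g x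
    using that by (auto simp: conjugacy_def)
  have obt: "\<exists>x\<in>carrier G. h = x \<otimes> g \<otimes> inv x" "g \<in> carrier G" if "(g, h) \<in> conjugacy G" for g h
    using that by (simp_all add: conjugacy_def)
  show "(h, g) \<in> conjugacy G" if "(g, h) \<in> conjugacy G" for g h
  proof -
    from obt[OF that] obtain x where g: "g \<in> carrier G" and x: "x \<in> carrier G" "h = x \<otimes> g \<otimes> inv x"
      by blast
    have "inv x \<otimes> (x \<otimes> g) = g" using g x(1) by (simp flip: m_assoc)
    then have "inv x \<otimes> h \<otimes> inv (inv x) = g" using g x by (simp add: m_assoc)
    with conj[of h "inv x"] g x show ?thesis by simp
  qed
  show "(g, k) \<in> conjugacy G" if gh: "(g, h) \<in> conjugacy G" and hk: "(h, k) \<in> conjugacy G" for g h k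
  proof -
    from obt[OF gh] obtain x where g: "g \<in> carrier G" and x: "x \<in> carrier G" "h = x \<otimes> g \<otimes> inv x"
      by blast
    from obt[OF hk] obtain y where y: "y \<in> carrier G" "k = y \<otimes> h \<otimes> inv y" by blast
    have "(y \<otimes> x) \<otimes> g \<otimes> inv (y \<otimes> x) = k"
      using g x y by (simp add: m_assoc inv_mult_group)
    with conj[of g "y \<otimes> x"] g x(1) y(1) show ?thesis by simp
  qed
qed

end

theory Submission
  imports Defs
begin

text \<open>
  Write \<open>m = 2 * n\<close>. The group consists of the \<open>m\<close> rotations \<open>\<alpha>\<^sup>i\<close> and the \<open>m\<close> flips
  \<open>\<alpha>\<^sup>i \<beta>\<close>, and \<open>Z = {1, \<alpha>\<^sup>n}\<close> is its center. Rotations commute with each other, no noncentral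
  rotation commutes with a flip, and \<open>\<alpha>\<^sup>i \<beta>\<close> commutes with \<open>\<alpha>\<^sup>j \<beta>\<close> exactly if \<open>n\<close> divides
  \<open>i - j\<close>. Hence, whenever the equivalence relation preserves \<open>Z\<close> and the set of flips, the super
  commuting graph consists of two vertices adjacent to everything, a clique on the \<open>m - 2\<close>
  noncentral rotations, and some graph on the flips, with no edge between these two parts. In the
  cases that occur the graph on the flips is a disjoint union of cliques of a common size \<open>k\<close>; only
  its regularity of degree \<open>k - 1\<close> matters. For equality \<open>k = 2\<close>, for conjugacy \<open>k = n\<close> or
  \<open>k = m\<close> as \<open>n\<close> is even or odd, because conjugation moves a flip exactly through the flips with
  the same parity of exponent; and for equality of orders with \<open>n\<close> odd \<open>k = m\<close>, because then the
  flips are exactly the elements of order 4.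

  For such a graph both sides of the inequality are explicit, and clearing denominators the
  difference is
  \<open>|V| * 2 M\<^sub>2 - M\<^sub>1 * 2 |E| = m\<^sup>2 * ((m - k)\<^sup>2 * (m + k - 4) + 2 k * (m + k - 6) + 4 m)\<close>,
  which is nonnegative for \<open>m \<ge> 4\<close> and \<open>k \<ge> 2\<close>. This is lemma \<open>hansen_vukicevic_cone\<close>, applied to
  groups in \<open>hansen_vukicevic_super_commuting_graph\<close>.

  The remaining case is equality of orders with \<open>n\<close> even. Then the rotation \<open>\<alpha>\<close> to the power
  \<open>n / 2\<close> has order 4 like the flips, so every flip is adjacent to every rotation; the graph is
  complete, and regular graphs satisfy the inequality with equality.

  That the group defined by the presentation has no further collapse is shown by letting words act
  on normal forms \<open>\<alpha>\<^sup>i \<beta>\<^sup>e\<close>, with \<open>i\<close> reduced modulo \<open>m\<close> (lemma \<open>word_action_cong\<close>).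
\<close>

section \<open>Degree sums in finite simple graphs\<close>

locale simple_graph =
  fixes \<Gamma> :: "'v sgraph"
  assumes finite_verts: "finite (verts \<Gamma>)"
    and edges_pairs: "e \<in> edges \<Gamma> \<Longrightarrow> \<exists>u\<in>verts \<Gamma>. \<exists>v\<in>verts \<Gamma>. u \<noteq> v \<and> e = {u, v}"
begin

definition neighbours :: "'v \<Rightarrow> 'v set" where
  "neighbours v = {w. {v, w} \<in> edges \<Gamma>}"

lemma neighbours_subset: "neighbours v \<subseteq> verts \<Gamma>"
proof
  fix w assume "w \<in> neighbours v"
  then obtain x y where "x \<in> verts \<Gamma>" "y \<in> verts \<Gamma>" "{v, w} = {x, y}"
    unfolding neighbours_def using edges_pairs by blast
  then show "w \<in> verts \<Gamma>" by (auto simp: doubleton_eq_iff)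
qed

lemma finite_neighbours: "finite (neighbours v)"
  using neighbours_subset finite_verts finite_subset by blast

lemma finite_edges: "finite (edges \<Gamma>)"
proof (rule finite_subset)
  show "edges \<Gamma> \<subseteq> Pow (verts \<Gamma>)" using edges_pairs by blast
qed (simp add: finite_verts)

lemma vertex_degree_eq: "vertex_degree \<Gamma> v = card (neighbours v)"
proof -
  have "bij_betw (\<lambda>w. {v, w}) (neighbours v) {e \<in> edges \<Gamma>. v \<in> e}"
    unfolding bij_betw_def
  proof
    show "inj_on (\<lambda>w. {v, w}) (neighbours v)"
      by (auto simp: inj_on_def doubleton_eq_iff)
    have "e \<in> (\<lambda>w. {v, w}) ` neighbours v" if "e \<in> edges \<Gamma>" "v \<in> e" for e
    proof -
      obtain x y where "e = {x, y}" using edges_pairs \<open>e \<in> edges \<Gamma>\<close> by blast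
      then have "e = {v, x} \<or> e = {v, y}" using \<open>v \<in> e\<close> by auto
      then show ?thesis using \<open>e \<in> edges \<Gamma>\<close> by (auto simp: neighbours_def)
    qed
    then show "(\<lambda>w. {v, w}) ` neighbours v = {e \<in> edges \<Gamma>. v \<in> e}"
      by (auto simp: neighbours_def)
  qed
  then show ?thesis by (simp add: vertex_degree_def bij_betw_same_card)
qed

text \<open>Every edge \<open>{v, w}\<close> arises from exactly two ordered pairs, \<open>(v, w)\<close> and \<open>(w, v)\<close>. Both the handshake
  lemma and the formula for the second Zagreb index are instances; they replace sums over edges by
  sums over vertices, which depend only on the neighbourhoods.\<close>

lemma sum_over_neighbours:
  fixes f :: "'v set \<Rightarrow> nat"
  shows "(\<Sum>v\<in>verts \<Gamma>. \<Sum>w\<in>neighbours v. f {v, w}) = 2 * (\<Sum>e\<in>edges \<Gamma>. f e)"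
proof -
  define P where "P = (SIGMA v:verts \<Gamma>. neighbours v)"
  have finP: "finite P"
    unfolding P_def by (intro finite_SigmaI finite_verts finite_neighbours)
  have fibre: "(\<Sum>p\<in>{p \<in> P. {fst p, snd p} = e}. f {fst p, snd p}) = 2 * f e"
    if e: "e \<in> edges \<Gamma>" for e
  proof -
    obtain u v where uv: "u \<in> verts \<Gamma>" "v \<in> verts \<Gamma>" "u \<noteq> v" "e = {u, v}"
      using edges_pairs[OF e] by blast
    have "{p \<in> P. {fst p, snd p} = e} = {(u, v), (v, u)}"
      using uv e by (auto simp: P_def neighbours_def doubleton_eq_iff insert_commute)
    then show ?thesis using uv by (simp add: insert_commute)
  qed
  have "(\<Sum>v\<in>verts \<Gamma>. \<Sum>w\<in>neighbours v. f {v, w}) = (\<Sum>p\<in>P. f {fst p, snd p})"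
    unfolding P_def by (subst sum.Sigma) (auto simp: finite_verts finite_neighbours split_def)
  also have "\<dots> = (\<Sum>e\<in>edges \<Gamma>. \<Sum>p\<in>{p \<in> P. {fst p, snd p} = e}. f {fst p, snd p})"
    by (rule sum.group[symmetric]) (use finP in \<open>auto simp: finite_edges P_def neighbours_def\<close>)
  also have "\<dots> = 2 * (\<Sum>e\<in>edges \<Gamma>. f e)"
    unfolding sum_distrib_left by (rule sum.cong[OF HOL.refl]) (rule fibre)
  finally show ?thesis .
qed

lemma handshake: "(\<Sum>v\<in>verts \<Gamma>. vertex_degree \<Gamma> v) = 2 * card (edges \<Gamma>)"
  using sum_over_neighbours[of "\<lambda>_. 1"] by (simp add: vertex_degree_eq)

lemma zagreb2_twice:
  "(\<Sum>v\<in>verts \<Gamma>. vertex_degree \<Gamma> v * (\<Sum>w\<in>neighbours v. vertex_degree \<Gamma> w)) = 2 * zagreb2 \<Gamma>"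
proof -
  have "(\<Sum>w\<in>neighbours v. \<Prod>x\<in>{v, w}. vertex_degree \<Gamma> x)
      = vertex_degree \<Gamma> v * (\<Sum>w\<in>neighbours v. vertex_degree \<Gamma> w)" for v
  proof -
    have "w \<noteq> v" if "w \<in> neighbours v" for w
      using that edges_pairs by (fastforce simp: neighbours_def)
    then have "(\<Prod>x\<in>{v, w}. vertex_degree \<Gamma> x) = vertex_degree \<Gamma> v * vertex_degree \<Gamma> w"
      if "w \<in> neighbours v" for w
      using that by (subst prod.insert) auto
    then show ?thesis by (simp add: sum_distrib_left)
  qed
  then show ?thesis
    using sum_over_neighbours[of "\<lambda>e. \<Prod>x\<in>e. vertex_degree \<Gamma> x"] by (simp add: zagreb2_def)
qed

end

section \<open>The inequality for two families of graphs\<close>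

definition hansen_vukicevic :: "'v sgraph \<Rightarrow> bool" where
  "hansen_vukicevic \<Gamma> \<longleftrightarrow>
    real (zagreb1 \<Gamma>) / real (card (verts \<Gamma>)) \<le> real (zagreb2 \<Gamma>) / real (card (edges \<Gamma>))"

context simple_graph
begin

lemma hansen_vukicevicI:
  assumes "edges \<Gamma> \<noteq> {}" "verts \<Gamma> \<noteq> {}"
    and "real (zagreb1 \<Gamma>) * real (2 * card (edges \<Gamma>)) \<le> real (2 * zagreb2 \<Gamma>) * real (card (verts \<Gamma>))"
  shows "hansen_vukicevic \<Gamma>"
proof -
  have "card (edges \<Gamma>) > 0" "card (verts \<Gamma>) > 0"
    using assms(1,2) finite_edges finite_verts by (simp_all add: card_gt_0_iff)
  then show ?thesis using assms(3) by (simp add: hansen_vukicevic_def field_simps)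
qed

lemma hansen_vukicevic_regular:
  assumes edges: "edges \<Gamma> \<noteq> {}" and reg: "\<And>v. v \<in> verts \<Gamma> \<Longrightarrow> vertex_degree \<Gamma> v = d"
  shows "hansen_vukicevic \<Gamma>"
proof (rule hansen_vukicevicI)
  show "verts \<Gamma> \<noteq> {}" using edges edges_pairs by blast
  have "2 * zagreb2 \<Gamma> = (\<Sum>v\<in>verts \<Gamma>. d * (card (neighbours v) * d))"
    using neighbours_subset by (auto simp: reg subset_iff simp flip: zagreb2_twice intro!: sum.cong)
  also have "\<dots> = card (verts \<Gamma>) * d ^ 3"
    by (simp add: reg flip: vertex_degree_eq) (simp add: power3_eq_cube)
  finally have M2: "2 * zagreb2 \<Gamma> = card (verts \<Gamma>) * d ^ 3" .
  have M1: "zagreb1 \<Gamma> = card (verts \<Gamma>) * d ^ 2"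
    by (simp add: zagreb1_def reg)
  have E: "2 * card (edges \<Gamma>) = card (verts \<Gamma>) * d"
    by (simp add: reg flip: handshake)
  show "real (zagreb1 \<Gamma>) * real (2 * card (edges \<Gamma>)) \<le> real (2 * zagreb2 \<Gamma>) * real (card (verts \<Gamma>))"
    unfolding M1 M2 E by (simp add: power3_eq_cube power2_eq_square)
qed (use edges in auto)

text \<open>The graph is a cone with apex pair \<open>C\<close> over a clique \<open>A\<close> and, apart from it, a \<open>(k - 1)\<close>-regular
  graph on \<open>S\<close> in which \<open>T x\<close> is the closed neighbourhood of \<open>x\<close>. The degrees are \<open>2 m - 1\<close>, \<open>m - 1\<close> and
  \<open>k + 1\<close> on the three parts, and the sum of the degrees of the neighbours is constant on each of them,
  so all sums are polynomials in \<open>m\<close> and \<open>k\<close>. Keeping \<open>k\<close> as a variable lets one polynomial identity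
  serve every equivalence relation.\<close>

lemma hansen_vukicevic_cone:
  assumes verts: "verts \<Gamma> = C \<union> A \<union> S"
    and disj: "C \<inter> A = {}" "C \<inter> S = {}" "A \<inter> S = {}"
    and cards: "card C = 2" "card A = m - 2" "card S = m"
    and nC: "\<And>x. x \<in> C \<Longrightarrow> neighbours x = verts \<Gamma> - {x}"
    and nA: "\<And>x. x \<in> A \<Longrightarrow> neighbours x = C \<union> A - {x}"
    and nS: "\<And>x. x \<in> S \<Longrightarrow> neighbours x = C \<union> T x - {x}"
    and T: "\<And>x. x \<in> S \<Longrightarrow> x \<in> T x \<and> T x \<subseteq> S \<and> card (T x) = k"
    and m: "4 \<le> m" and k: "2 \<le> k"
  shows "hansen_vukicevic \<Gamma>"
proof (rule hansen_vukicevicI)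
  define d where "d v = real (vertex_degree \<Gamma> v)" for v
  have fin: "finite C" "finite A" "finite S" using finite_verts verts by auto
  have finT: "finite (T x)" if "x \<in> S" for x using T[OF that] fin(3) finite_subset by blast
  have sum_verts: "(\<Sum>v\<in>verts \<Gamma>. f v) = (\<Sum>v\<in>C. f v) + (\<Sum>v\<in>A. f v) + (\<Sum>v\<in>S. f v)"
    for f :: "'v \<Rightarrow> real"
  proof -
    have "(C \<union> A) \<inter> S = {}" using disj by blast
    then show ?thesis
      unfolding verts using fin disj(1) by (simp add: sum.union_disjoint)
  qed
  have card_verts: "card (verts \<Gamma>) = 2 * m"
    using sum_verts[of "\<lambda>_. 1"] cards m by simp
  have dC: "d x = 2 * real m - 1" if "x \<in> C" for x
  proof -
    have "card (verts \<Gamma> - {x}) = 2 * m - 1"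
      using that finite_verts card_verts verts by (simp add: card_Diff_singleton)
    then show ?thesis using m nC[OF that] by (simp add: d_def vertex_degree_eq of_nat_diff)
  qed
  have dA: "d x = real m - 1" if "x \<in> A" for x
  proof -
    have "card (C \<union> A - {x}) = m - 1"
      using that fin disj cards m by (simp add: card_Diff_singleton card_Un_disjoint)
    then show ?thesis using m nA[OF that] by (simp add: d_def vertex_degree_eq of_nat_diff)
  qed
  have dS: "d x = real k + 1" if "x \<in> S" for x
  proof -
    have "C \<inter> T x = {}" using T[OF that] disj by auto
    then have "card (C \<union> T x - {x}) = k + 1"
      using that fin finT T[OF that] cards k by (simp add: card_Diff_singleton card_Un_disjoint)
    then show ?thesis using nS[OF that] by (simp add: d_def vertex_degree_eq)
  qed
  \<comment> \<open>The degree sum over the neighbourhood; twice the second Zagreb index is the sum of \<open>d v * s v\<close>.\<close>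
  define s where "s v = (\<Sum>w\<in>neighbours v. d w)" for v
  have dCsum: "sum d C = 2 * (2 * real m - 1)"
    and dAsum: "sum d A = (real m - 2) * (real m - 1)"
    and dSsum: "sum d S = real m * (real k + 1)"
    using dC dA dS cards m by (simp_all add: of_nat_diff distrib_left)
  have sC: "s x = (2 * real m - 1) + (real m - 2) * (real m - 1) + real m * (real k + 1)" if "x \<in> C" for x
  proof -
    have "s x = sum d (verts \<Gamma>) - d x"
      unfolding s_def nC[OF that] using that verts finite_verts by (subst sum_diff1) auto
    then show ?thesis using dC[OF that] sum_verts[of d] dCsum dAsum dSsum by simp
  qed
  have sA: "s x = 2 * (2 * real m - 1) + (real m - 3) * (real m - 1)" if "x \<in> A" for x
  proof -
    have "s x = sum d C + sum d A - d x"
      unfolding s_def nA[OF that] using that fin disj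
      by (subst sum_diff1) (auto simp: sum.union_disjoint)
    then show ?thesis using dA[OF that] dCsum dAsum by (simp add: algebra_simps)
  qed
  have sS: "s x = 2 * (2 * real m - 1) + (real k - 1) * (real k + 1)" if "x \<in> S" for x
  proof -
    have "C \<inter> T x = {}" using T[OF that] disj by auto
    then have "s x = sum d C + sum d (T x) - d x"
      unfolding s_def nS[OF that] using that fin finT T[OF that]
      by (subst sum_diff1) (auto simp: sum.union_disjoint)
    moreover have "sum d (T x) = (\<Sum>_\<in>T x. real k + 1)"
      using T[OF that] dS by (intro sum.cong) auto
    ultimately show ?thesis using dS[OF that] T[OF that] dCsum by (simp add: algebra_simps)
  qed
  have E: "real (2 * card (edges \<Gamma>)) = real m * (real m + real k + 2)"
  proof -
    have "real (2 * card (edges \<Gamma>)) = sum d (verts \<Gamma>)"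
      by (simp add: d_def flip: handshake)
    then show ?thesis unfolding sum_verts dCsum dAsum dSsum by (simp add: algebra_simps)
  qed
  have M1: "real (zagreb1 \<Gamma>)
      = 2 * (2 * real m - 1)\<^sup>2 + (real m - 2) * (real m - 1)\<^sup>2 + real m * (real k + 1)\<^sup>2"
  proof -
    have "real (zagreb1 \<Gamma>) = (\<Sum>v\<in>verts \<Gamma>. (d v)\<^sup>2)" by (simp add: zagreb1_def d_def)
    then show ?thesis unfolding sum_verts using dC dA dS cards m by (simp add: of_nat_diff)
  qed
  have M2: "real (2 * zagreb2 \<Gamma>)
      = 2 * ((2 * real m - 1) * ((2 * real m - 1) + (real m - 2) * (real m - 1) + real m * (real k + 1)))
      + (real m - 2) * ((real m - 1) * (2 * (2 * real m - 1) + (real m - 3) * (real m - 1)))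
      + real m * ((real k + 1) * (2 * (2 * real m - 1) + (real k - 1) * (real k + 1)))"
  proof -
    have "real (2 * zagreb2 \<Gamma>) = (\<Sum>v\<in>verts \<Gamma>. d v * s v)"
      unfolding zagreb2_twice[symmetric] by (simp add: d_def s_def)
    then show ?thesis unfolding sum_verts using dC dA dS sC sA sS cards m by (simp add: of_nat_diff)
  qed
  \<comment> \<open>Grouping the difference around \<open>m - k\<close> makes every summand nonnegative.\<close>
  have "real (2 * zagreb2 \<Gamma>) * real (card (verts \<Gamma>)) - real (zagreb1 \<Gamma>) * real (2 * card (edges \<Gamma>))
      = (real m)\<^sup>2 * ((real m - real k)\<^sup>2 * (real m + real k - 4) + 2 * real k * (real m + real k - 6) + 4 * real m)"
    unfolding M1 M2 E card_verts using m by (simp add: of_nat_diff) (simp add: algebra_simps power2_eq_square)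
  moreover have "0 \<le> (real m - real k)\<^sup>2 * (real m + real k - 4) + 2 * real k * (real m + real k - 6) + 4 * real m"
    using m k by (intro add_nonneg_nonneg mult_nonneg_nonneg) auto
  ultimately show "real (zagreb1 \<Gamma>) * real (2 * card (edges \<Gamma>))
      \<le> real (2 * zagreb2 \<Gamma>) * real (card (verts \<Gamma>))"
    by (smt (verit) mult_nonneg_nonneg zero_le_power2)
  show "edges \<Gamma> \<noteq> {}" using E m by auto
  show "verts \<Gamma> \<noteq> {}" using card_verts m by auto
qed

end

section \<open>Groups satisfying the quaternion relations\<close>

text \<open>The range is in bijection with the residues modulo \<open>m\<close>.\<close>

lemma card_range_periodic:
  assumes "0 < m" "\<And>i j. f i = f j \<longleftrightarrow> int m dvd i - j"
  shows "card (range f) = m" "finite (range f)"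
proof -
  have "range f = f ` {0..<int m}"
  proof -
    have "f i \<in> f ` {0..<int m}" for i
    proof (rule image_eqI)
      show "f i = f (i mod int m)" using assms by (simp add: minus_mod_eq_mult_div)
      show "i mod int m \<in> {0..<int m}" using assms(1) by simp
    qed
    then show ?thesis by blast
  qed
  moreover have "inj_on f {0..<int m}"
  proof (rule inj_onI)
    fix i j assume "i \<in> {0..<int m}" "j \<in> {0..<int m}" "f i = f j"
    then show "i = j"
      using assms by (metis atLeastLessThan_iff mod_eq_dvd_iff mod_pos_pos_trivial)
  qed
  ultimately show "card (range f) = m" "finite (range f)"
    by (simp_all add: card_image)
qed

text \<open>The relations alone, without any claim that they generate or present the group. They already
  determine how products of rotations and flips are computed, which is what the analysis of
  the presented group starts from.\<close>

locale quaternion_generators = group G for G (structure) +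
  fixes n :: nat and \<alpha> \<beta>
  assumes n_ge_2: "2 \<le> n"
    and \<alpha>[simp]: "\<alpha> \<in> carrier G" and \<beta>[simp]: "\<beta> \<in> carrier G"
    and \<alpha>_pow: "\<alpha> [^] (2 * n) = \<one>"
    and \<beta>_square: "\<alpha> [^] n = \<beta> \<otimes> \<beta>"
    and \<beta>_conj: "\<beta> \<otimes> \<alpha> \<otimes> inv \<beta> = inv \<alpha>"
begin

definition rot :: "int \<Rightarrow> 'a" where "rot i = \<alpha> [^] i"
definition flip :: "int \<Rightarrow> 'a" where "flip i = rot i \<otimes> \<beta>"

lemma rot_closed [simp]: "rot i \<in> carrier G"
  by (simp add: rot_def)

lemma flip_closed [simp]: "flip i \<in> carrier G"
  by (simp add: flip_def)

lemma rot_0 [simp]: "rot 0 = \<one>"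
  by (simp add: rot_def)

lemma rot_rot [simp]: "rot i \<otimes> rot j = rot (i + j)"
  by (simp add: rot_def int_pow_mult)

lemma inv_rot [simp]: "inv (rot i) = rot (- i)"
  by (simp add: rot_def int_pow_neg)

lemma rot_flip [simp]: "rot i \<otimes> flip j = flip (i + j)"
  by (simp add: flip_def flip: m_assoc)

lemma \<beta>_\<beta>: "\<beta> \<otimes> \<beta> = rot n"
  by (simp add: rot_def int_pow_int \<beta>_square)

text \<open>Moving \<open>\<beta>\<close> past \<open>\<alpha>\<close> inverts \<open>\<alpha>\<close>; iterating gives the claim for nonnegative \<open>i\<close>, and the negative
  case follows by multiplying \<open>\<beta> rot k = rot (- k) \<beta>\<close> by \<open>rot k\<close> on the left and by its inverse on the
  right.\<close>

lemma \<beta>_rot: "\<beta> \<otimes> rot i = flip (- i)"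
proof -
  have step: "\<beta> \<otimes> \<alpha> = inv \<alpha> \<otimes> \<beta>"
    using \<beta>_conj by (simp add: inv_solve_right')
  have nat: "\<beta> \<otimes> \<alpha> [^] k = inv \<alpha> [^] k \<otimes> \<beta>" for k :: nat
  proof (induction k)
    case (Suc k)
    have "\<beta> \<otimes> \<alpha> [^] Suc k = inv \<alpha> [^] k \<otimes> (\<beta> \<otimes> \<alpha>)"
      using Suc by (simp flip: m_assoc)
    then show ?case by (simp add: step flip: m_assoc)
  qed simp
  have pos: "\<beta> \<otimes> rot (int k) = flip (- int k)" for k
    using nat[of k] by (simp add: flip_def rot_def int_pow_int int_pow_neg nat_pow_inv)
  show ?thesis
  proof (cases "0 \<le> i")
    case True
    then show ?thesis using pos[of "nat i"] by simp
  next
    case False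
    define k where "k = nat (- i)"
    have i: "i = - int k" using False by (simp add: k_def)
    have "\<beta> \<otimes> rot (- int k) = rot (int k) \<otimes> (rot (- int k) \<otimes> \<beta>) \<otimes> rot (- int k)"
      by (simp flip: m_assoc)
    also have "\<dots> = rot (int k) \<otimes> (\<beta> \<otimes> rot (int k)) \<otimes> rot (- int k)"
      by (simp add: pos flip_def)
    also have "\<dots> = rot (int k) \<otimes> \<beta>"
      by (simp add: m_assoc)
    finally show ?thesis by (simp add: i flip_def)
  qed
qed

lemma flip_rot [simp]: "flip i \<otimes> rot j = flip (i - j)"
proof -
  have "flip i \<otimes> rot j = rot i \<otimes> (\<beta> \<otimes> rot j)" by (simp add: flip_def m_assoc)
  then show ?thesis by (simp add: \<beta>_rot)
qed

lemma flip_flip [simp]: "flip i \<otimes> flip j = rot (i - j + n)"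
proof -
  have "flip i \<otimes> flip j = (flip i \<otimes> rot j) \<otimes> \<beta>"
    by (simp add: flip_def[of j] m_assoc del: flip_rot)
  also have "\<dots> = rot (i - j) \<otimes> (\<beta> \<otimes> \<beta>)"
    by (simp only: flip_rot) (simp add: flip_def m_assoc)
  finally show ?thesis by (simp add: \<beta>_\<beta>)
qed

lemma rot_2n: "rot (2 * n) = \<one>"
  using \<alpha>_pow int_pow_int[of G \<alpha> "2 * n"] by (simp add: rot_def)

lemma rot_eq_one: "2 * int n dvd i \<Longrightarrow> rot i = \<one>"
  using rot_2n by (auto simp: rot_def elim!: dvdE simp flip: int_pow_pow)

lemma inv_flip [simp]: "inv (flip i) = flip (i + n)"
  by (intro inv_equality) (simp_all add: rot_eq_one)

end

text \<open>Here the generators generate, and the listed elements coincide only where the relations force it,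
  so the group has order \<open>4 * n\<close>. These are the facts about the presented group from which its
  super commuting graphs are computed.\<close>

locale quaternion_elements = quaternion_generators +
  assumes carrier_cases: "x \<in> carrier G \<Longrightarrow> x \<in> range rot \<union> range flip"
    and rot_eq_oneD: "rot i = \<one> \<Longrightarrow> 2 * int n dvd i"
    and \<beta>_not_rot: "\<beta> \<noteq> rot i"
begin

lemma rot_eq_iff [simp]: "rot i = rot j \<longleftrightarrow> 2 * int n dvd i - j"
proof -
  have "rot i = rot j \<longleftrightarrow> rot i \<otimes> inv (rot j) = \<one>"
    using inv_solve_right'[of \<one> "rot i" "rot j"] by (auto simp del: inv_rot rot_rot)
  then show ?thesis using rot_eq_one[of "i - j"] rot_eq_oneD[of "i - j"] by auto
qed

lemma rot_eq_one_iff [simp]: "rot i = \<one> \<longleftrightarrow> 2 * int n dvd i"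
  using rot_eq_iff[of i 0] by (simp del: rot_eq_iff)

lemma flip_eq_iff [simp]: "flip i = flip j \<longleftrightarrow> 2 * int n dvd i - j"
  by (simp add: flip_def)

lemma rot_neq_flip [simp]: "rot i \<noteq> flip j" "flip j \<noteq> rot i"
proof -
  show "rot i \<noteq> flip j"
  proof
    assume "rot i = flip j"
    then have "rot (- j) \<otimes> rot i = rot (- j) \<otimes> flip j" by simp
    then have "rot (i - j) = flip 0" by (simp only: rot_rot rot_flip) simp
    then show False using \<beta>_not_rot[of "i - j"] by (simp add: flip_def)
  qed
  then show "flip j \<noteq> rot i" by simp
qed

lemma range_cases:
  assumes "x \<in> carrier G"
  obtains (rot) i where "x = rot i" | (flip) i where "x = flip i"
  using carrier_cases[OF assms] by auto

definition center :: "'a set" where "center = {\<one>, rot n}"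
abbreviation noncentral_rots :: "'a set" where "noncentral_rots \<equiv> range rot - center"
abbreviation flips :: "'a set" where "flips \<equiv> range flip"

lemma two_n_dvd_double_iff: "2 * int n dvd i - (- i) \<longleftrightarrow> int n dvd i"
  using dvd_mult_cancel_left[of 2 "int n" i] by simp

lemma rot_in_center_iff [simp]: "rot i \<in> center \<longleftrightarrow> int n dvd i"
proof
  assume "rot i \<in> center"
  then have "2 * int n dvd i \<or> 2 * int n dvd i - n" by (auto simp: center_def)
  then have "int n dvd i \<or> int n dvd i - n" using dvd_mult_right by blast
  then show "int n dvd i" by (simp add: dvd_diff_left_iff)
next
  assume "int n dvd i"
  then obtain k where k: "i = int n * k" by blast
  show "rot i \<in> center"
  proof (cases "even k")
    case True
    then show ?thesis by (auto simp: center_def k elim!: evenE)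
  next
    case False
    then obtain l where "k = 2 * l + 1" by (rule oddE)
    then have "i - n = 2 * int n * l" by (simp add: k algebra_simps)
    then show ?thesis by (simp add: center_def)
  qed
qed

lemma flip_notin_center [simp]: "flip i \<notin> center"
  by (metis center_def insert_iff rot_0 rot_neq_flip(2) singletonD)

lemma center_commutes: "x \<in> center \<Longrightarrow> y \<in> carrier G \<Longrightarrow> x \<otimes> y = y \<otimes> x"
  by (erule range_cases) (auto simp: center_def add.commute)

lemma rot_flip_commute_iff: "rot i \<otimes> flip j = flip j \<otimes> rot i \<longleftrightarrow> rot i \<in> center"
  using two_n_dvd_double_iff[of i] by (simp add: algebra_simps)

lemma flip_flip_commute_iff: "flip i \<otimes> flip j = flip j \<otimes> flip i \<longleftrightarrow> int n dvd i - j"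
proof -
  \<comment> \<open>Both products are rotations; their exponents differ by \<open>2 * (i - j)\<close>.\<close>
  have "i - j + n - (j - i + n) = (i - j) - (- (i - j))" by simp
  then show ?thesis by (simp only: flip_flip rot_eq_iff two_n_dvd_double_iff)
qed

lemma card_center: "card center = 2"
proof -
  have "\<not> 2 * int n dvd int n" using n_ge_2 by (auto dest: zdvd_imp_le)
  then have "\<one> \<noteq> rot n" using rot_eq_one_iff[of n] by metis
  then show ?thesis by (simp add: center_def)
qed

lemma center_subset: "center \<subseteq> range rot"
proof -
  have "\<one> = rot 0" by simp
  then show ?thesis by (auto simp: center_def simp del: rot_0)
qed

lemma card_noncentral_rots: "card noncentral_rots = 2 * n - 2"
  using center_subset card_center card_range_periodic[where f = rot and m = "2 * n"] n_ge_2
  by (simp add: card_Diff_subset center_def)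

lemma card_flips: "card flips = 2 * n"
  using n_ge_2 by (intro card_range_periodic) auto

lemma carrier_eq: "carrier G = center \<union> noncentral_rots \<union> flips"
  using carrier_cases center_subset by auto

lemma finite_carrier: "finite (carrier G)"
  using card_range_periodic[where f = rot and m = "2 * n"]
    card_range_periodic[where f = flip and m = "2 * n"] carrier_eq center_subset n_ge_2
  by (simp add: finite_subset)

end

section \<open>Super commuting graphs of quaternion groups\<close>

definition super_adjacent :: "('g, 'm) monoid_scheme \<Rightarrow> ('g \<times> 'g) set \<Rightarrow> 'g \<Rightarrow> 'g \<Rightarrow> bool" where
  "super_adjacent G B g h \<longleftrightarrow> B `` {g} = B `` {h} \<or>
    (\<exists>g'\<in>B `` {g}. \<exists>h'\<in>B `` {h}. g' \<otimes>\<^bsub>G\<^esub> h' = h' \<otimes>\<^bsub>G\<^esub> g')"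

lemma super_adjacent_sym: "super_adjacent G B g h \<Longrightarrow> super_adjacent G B h g"
  unfolding super_adjacent_def by metis

lemma verts_super_commuting_graph [simp]: "verts (super_commuting_graph G B) = carrier G"
  by (simp add: super_commuting_graph_def)

lemma edges_super_commuting_graph:
  "edges (super_commuting_graph G B) =
    {{g, h} | g h. g \<in> carrier G \<and> h \<in> carrier G \<and> g \<noteq> h \<and> super_adjacent G B g h}"
  by (simp add: super_commuting_graph_def super_adjacent_def)

lemma simple_graph_super_commuting_graph:
  "finite (carrier G) \<Longrightarrow> simple_graph (super_commuting_graph G B)"
  by unfold_locales (auto simp: edges_super_commuting_graph)

lemma neighbours_super_commuting_graph:
  assumes "finite (carrier G)" "g \<in> carrier G"
  shows "simple_graph.neighbours (super_commuting_graph G B) g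
    = {h \<in> carrier G. super_adjacent G B g h} - {g}"
proof -
  interpret simple_graph "super_commuting_graph G B"
    by (rule simple_graph_super_commuting_graph) fact
  show ?thesis
    using assms(2)
    by (auto simp: neighbours_def edges_super_commuting_graph doubleton_eq_iff
        intro: super_adjacent_sym)
qed

lemma super_adjacent_if_commute:
  assumes "equiv (carrier G) B" "g \<in> carrier G" "h \<in> carrier G"
    and "g \<otimes>\<^bsub>G\<^esub> h = h \<otimes>\<^bsub>G\<^esub> g"
  shows "super_adjacent G B g h"
  using assms equiv_class_self unfolding super_adjacent_def by metis

lemma hansen_vukicevic_complete:
  assumes fin: "finite (carrier G)" and gh: "g \<in> carrier G" "h \<in> carrier G" "g \<noteq> h"
    and adj: "\<And>x y. x \<in> carrier G \<Longrightarrow> y \<in> carrier G \<Longrightarrow> super_adjacent G B x y"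
  shows "hansen_vukicevic (super_commuting_graph G B)"
proof -
  interpret simple_graph "super_commuting_graph G B"
    by (rule simple_graph_super_commuting_graph) fact
  show ?thesis
  proof (rule hansen_vukicevic_regular)
    have "{g, h} \<in> edges (super_commuting_graph G B)"
      using gh adj unfolding edges_super_commuting_graph by blast
    then show "edges (super_commuting_graph G B) \<noteq> {}" by blast
    fix x assume "x \<in> verts (super_commuting_graph G B)"
    then have x: "x \<in> carrier G" by simp
    have "neighbours x = carrier G - {x}"
      using neighbours_super_commuting_graph[OF fin x] adj[OF x] by auto
    then show "vertex_degree (super_commuting_graph G B) x = card (carrier G) - 1"
      using x by (simp add: vertex_degree_eq card_Diff_singleton)
  qed
qed

context quaternion_elements
begin

text \<open>If the relation preserves the center and the flips, it also preserves the noncentral rotations, so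
  representatives cannot create an edge between a noncentral rotation and a flip. All edges other than
  those among the flips are then the same as for equality, and the graph is a cone as above.\<close>

lemma hansen_vukicevic_super_commuting_graph:
  assumes B: "equiv (carrier G) B"
    and center: "\<And>x y. x \<in> center \<Longrightarrow> (x, y) \<in> B \<Longrightarrow> y \<in> center"
    and flips: "\<And>x y. x \<in> flips \<Longrightarrow> (x, y) \<in> B \<Longrightarrow> y \<in> flips"
    and k: "\<And>x. x \<in> flips \<Longrightarrow> card {y \<in> flips. super_adjacent G B x y} = k" "2 \<le> k"
  shows "hansen_vukicevic (super_commuting_graph G B)"
proof -
  let ?\<Gamma> = "super_commuting_graph G B" and ?adj = "super_adjacent G B"
  interpret simple_graph ?\<Gamma>
    by (rule simple_graph_super_commuting_graph) (rule finite_carrier)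
  have Bsym: "(y, x) \<in> B" if "(x, y) \<in> B" for x y
    using B that by (meson equivE symE)
  have commute: "?adj x y" if "x \<in> carrier G" "y \<in> carrier G" "x \<otimes> y = y \<otimes> x" for x y
    using B that by (rule super_adjacent_if_commute)
  have center_adj: "?adj x y" "?adj y x" if "x \<in> center" "y \<in> carrier G" for x y
  proof -
    have "x \<in> carrier G" using that(1) carrier_eq by blast
    then show "?adj x y" using that(2) center_commutes[OF that] by (rule commute)
    then show "?adj y x" by (rule super_adjacent_sym)
  qed
  have rot_adj: "?adj x y" if "x \<in> range rot" "y \<in> range rot" for x y
    using that by (auto intro!: commute simp: add.commute)
  have not_adj: "\<not> ?adj x y" if x: "x \<in> noncentral_rots" and y: "y \<in> flips" for x y
  proof
    have cls_x: "x' \<in> noncentral_rots" if "(x, x') \<in> B" for x'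
    proof -
      have "x' \<in> carrier G" using B that by (auto simp: equiv_def refl_on_def)
      moreover have "x' \<notin> center" using x that Bsym center by blast
      moreover have "x \<notin> flips" using x by auto
      then have "x' \<notin> flips" using that Bsym flips by blast
      ultimately show ?thesis using carrier_eq by blast
    qed
    assume "?adj x y"
    then consider "B `` {x} = B `` {y}" | x' y' where "(x, x') \<in> B" "(y, y') \<in> B" "x' \<otimes> y' = y' \<otimes> x'"
      by (auto simp: super_adjacent_def)
    then show False
    proof cases
      case 1
      have "y \<in> carrier G" using y by auto
      then have "y \<in> B `` {x}" using 1 equiv_class_self[OF B] by blast
      then show False using cls_x[of y] y by auto
    next
      case 2
      then have "x' \<in> noncentral_rots" "y' \<in> flips" using cls_x flips y by auto
      then show False using 2(3) rot_flip_commute_iff by (auto simp del: rot_flip flip_rot)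
    qed
  qed
  have nb: "neighbours x = {y \<in> carrier G. ?adj x y} - {x}" if "x \<in> carrier G" for x
    using finite_carrier that by (rule neighbours_super_commuting_graph)
  show ?thesis
  proof (rule hansen_vukicevic_cone[where C = center and A = noncentral_rots and S = flips
        and m = "2 * n" and T = "\<lambda>x. {y \<in> flips. ?adj x y}"])
    show "verts ?\<Gamma> = center \<union> noncentral_rots \<union> flips" by (simp add: carrier_eq)
    show "center \<inter> flips = {}" "noncentral_rots \<inter> flips = {}" by auto
    fix x
    show "neighbours x = verts ?\<Gamma> - {x}" if "x \<in> center"
      using that center_adj nb[of x] carrier_eq by auto
    show "neighbours x = center \<union> noncentral_rots - {x}" if x: "x \<in> noncentral_rots"
    proof -
      have xc: "x \<in> carrier G" using x carrier_eq by blast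
      have "{y \<in> carrier G. ?adj x y} = center \<union> noncentral_rots"
        using not_adj[OF x] rot_adj[of x] x center_adj(2)[OF _ xc] unfolding carrier_eq by blast
      then show ?thesis using nb[OF xc] by simp
    qed
    show "neighbours x = center \<union> {y \<in> flips. ?adj x y} - {x}" if x: "x \<in> flips"
    proof -
      have xc: "x \<in> carrier G" using x carrier_eq by blast
      have "{y \<in> carrier G. ?adj x y} = center \<union> {y \<in> flips. ?adj x y}"
        using not_adj[OF _ x] center_adj(2)[OF _ xc] super_adjacent_sym[of G B x]
        unfolding carrier_eq by blast
      then show ?thesis using nb[OF xc] by simp
    qed
    show "x \<in> {y \<in> flips. ?adj x y} \<and> {y \<in> flips. ?adj x y} \<subseteq> flips
        \<and> card {y \<in> flips. ?adj x y} = k" if "x \<in> flips"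
      using that k(1) carrier_eq by (auto intro: commute)
  qed (use card_center card_noncentral_rots card_flips n_ge_2 k in auto)
qed

lemma flip_mem_pair_iff: "flip j \<in> {flip i, flip (i + n)} \<longleftrightarrow> int n dvd i - j"
proof -
  have "flip j \<in> {flip i, flip (i + n)} \<longleftrightarrow> rot (j - i) \<in> center"
    by (auto simp: center_def diff_diff_eq simp del: rot_in_center_iff)
  then show ?thesis by (simp add: dvd_diff_commute)
qed

lemma not_period_n: "\<not> 2 * int n dvd int n"
  using n_ge_2 by (auto dest: zdvd_imp_le)

lemma hansen_vukicevic_ESCom: "hansen_vukicevic (ESCom G)"
  unfolding ESCom_def
proof (rule hansen_vukicevic_super_commuting_graph)
  show "equiv (carrier G) (Id_on (carrier G))"
    by (auto intro!: equivI refl_onI symI transI)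
  fix x assume "x \<in> flips"
  then obtain i where i: "x = flip i" by auto
  have "super_adjacent G (Id_on (carrier G)) (flip i) (flip j) \<longleftrightarrow> int n dvd i - j" for j
  proof -
    have "super_adjacent G (Id_on (carrier G)) (flip i) (flip j) \<longleftrightarrow>
        flip i = flip j \<or> flip i \<otimes> flip j = flip j \<otimes> flip i"
      unfolding super_adjacent_def by (auto simp del: flip_flip flip_eq_iff)
    then show ?thesis unfolding flip_flip_commute_iff flip_eq_iff by (auto dest: dvd_mult_right)
  qed
  then have "super_adjacent G (Id_on (carrier G)) x (flip j) \<longleftrightarrow> flip j \<in> {flip i, flip (i + n)}" for j
    unfolding i flip_mem_pair_iff .
  then have "{y \<in> flips. super_adjacent G (Id_on (carrier G)) x y} = {flip i, flip (i + n)}"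
    by blast
  then show "card {y \<in> flips. super_adjacent G (Id_on (carrier G)) x y} = 2"
    using not_period_n by simp
qed auto

lemma conjugacy_rot:
  assumes "(rot i, y) \<in> conjugacy G"
  shows "y = rot i \<or> y = rot (- i)"
proof -
  obtain x where "x \<in> carrier G" "y = x \<otimes> rot i \<otimes> inv x"
    using assms by (auto simp: conjugacy_def)
  then show ?thesis by (cases rule: range_cases) simp_all
qed

lemma conjugacy_flip_iff: "(flip i, y) \<in> conjugacy G \<longleftrightarrow> (\<exists>j. y = flip (i + 2 * j))"
proof
  assume "(flip i, y) \<in> conjugacy G"
  then obtain x where x: "x \<in> carrier G" and y: "y = x \<otimes> flip i \<otimes> inv x"
    by (auto simp: conjugacy_def)
  from x show "\<exists>j. y = flip (i + 2 * j)"
  proof (cases rule: range_cases)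
    case (rot j)
    then have "y = flip (i + 2 * j)" by (simp add: y algebra_simps)
    then show ?thesis ..
  next
    case (flip j)
    then have "y = flip (i + 2 * (j - i))" by (simp add: y algebra_simps)
    then show ?thesis ..
  qed
next
  assume "\<exists>j. y = flip (i + 2 * j)"
  then obtain j where y: "y = flip (i + 2 * j)" by blast
  also have "flip (i + 2 * j) = rot j \<otimes> flip i \<otimes> inv (rot j)" by (simp add: algebra_simps)
  finally have "\<exists>x\<in>carrier G. y = x \<otimes> flip i \<otimes> inv x" by (rule bexI) (rule rot_closed)
  then show "(flip i, y) \<in> conjugacy G" by (simp add: conjugacy_def y)
qed

text \<open>Conjugates of \<open>flip i\<close> are the \<open>flip (i + 2 * s)\<close>, so the question is whether \<open>i - j\<close> is congruent
  modulo \<open>n\<close> to an even number. For even \<open>n\<close> this is a parity condition; for odd \<open>n\<close> the number 2 is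
  invertible modulo \<open>n\<close>.\<close>

lemma super_adjacent_conjugacy_flips_iff:
  "super_adjacent G (conjugacy G) (flip i) (flip j) \<longleftrightarrow> odd n \<or> even (i - j)"
proof -
  have "super_adjacent G (conjugacy G) (flip i) (flip j) \<longleftrightarrow>
      (\<exists>s t. int n dvd (i + 2 * s) - (j + 2 * t))" (is "_ = ?R")
  proof
    assume "super_adjacent G (conjugacy G) (flip i) (flip j)"
    then show ?R
      unfolding super_adjacent_def
    proof (elim disjE bexE)
      assume *: "conjugacy G `` {flip i} = conjugacy G `` {flip j}"
      have "flip i \<in> conjugacy G `` {flip i}"
        by (rule equiv_class_self[OF equiv_conjugacy]) simp
      then have "(flip j, flip i) \<in> conjugacy G" unfolding * by simp
      then obtain t where "flip i = flip (j + 2 * t)" unfolding conjugacy_flip_iff by blast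
      then have "2 * int n dvd (i + 2 * 0) - (j + 2 * t)" by simp
      then show ?R by (blast dest: dvd_mult_right)
    next
      fix g' h'
      assume "g' \<in> conjugacy G `` {flip i}" "h' \<in> conjugacy G `` {flip j}"
        and comm: "g' \<otimes> h' = h' \<otimes> g'"
      then obtain s t where "g' = flip (i + 2 * s)" "h' = flip (j + 2 * t)"
        unfolding Image_singleton_iff conjugacy_flip_iff by blast
      with comm have "int n dvd (i + 2 * s) - (j + 2 * t)"
        by (simp only: flip_flip_commute_iff)
      then show ?R by blast
    qed
  next
    assume ?R
    then obtain s t where "int n dvd (i + 2 * s) - (j + 2 * t)" by blast
    then have "flip (i + 2 * s) \<otimes> flip (j + 2 * t) = flip (j + 2 * t) \<otimes> flip (i + 2 * s)"
      by (simp only: flip_flip_commute_iff)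
    moreover have "flip (i + 2 * s) \<in> conjugacy G `` {flip i}"
      "flip (j + 2 * t) \<in> conjugacy G `` {flip j}"
      unfolding Image_singleton_iff conjugacy_flip_iff by blast+
    ultimately show "super_adjacent G (conjugacy G) (flip i) (flip j)"
      unfolding super_adjacent_def by blast
  qed
  also have "\<dots> \<longleftrightarrow> odd n \<or> even (i - j)"
  proof
    assume ?R
    then obtain s t where *: "int n dvd (i + 2 * s) - (j + 2 * t)" by blast
    have "even (i - j)" if "even n"
    proof -
      have "2 dvd (i + 2 * s) - (j + 2 * t)" using * that by (meson dvd_trans even_of_nat)
      then show ?thesis by simp
    qed
    then show "odd n \<or> even (i - j)" by blast
  next
    assume "odd n \<or> even (i - j)"
    then show ?R
    proof
      assume "odd n"
      then obtain q where "n = 2 * q + 1" by (rule oddE)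
      \<comment> \<open>\<open>q = (n - 1) / 2\<close>, so \<open>i - j + 2 q (i - j) = n (i - j)\<close>.\<close>
      then have "(i + 2 * (int q * (i - j))) - (j + 2 * 0) = int n * (i - j)"
        by (simp add: algebra_simps)
      then show ?R by (metis dvd_triv_left)
    next
      assume "even (i - j)"
      then obtain q where "i - j = 2 * q" by blast
      then have "(i + 2 * 0) - (j + 2 * q) = 0" by simp
      then have "int n dvd (i + 2 * 0) - (j + 2 * q)" by (simp only: dvd_0_right)
      then show ?R by blast
    qed
  qed
  finally show ?thesis .
qed

lemma card_flips_same_parity: "card {flip j | j. even (i - j)} = n"
proof -
  have "{flip j | j. even (i - j)} = range (\<lambda>t. flip (i + 2 * t))"
  proof -
    have "j \<in> range (\<lambda>t. i + 2 * t)" if "even (i - j)" for j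
      using that by (intro range_eqI[of _ _ "- ((i - j) div 2)"]) auto
    then have "{j. even (i - j)} = range (\<lambda>t. i + 2 * t)" by auto
    then show ?thesis by (simp add: setcompr_eq_image image_image)
  qed
  moreover have "card (range (\<lambda>t. flip (i + 2 * t))) = n"
  proof (rule card_range_periodic)
    show "flip (i + 2 * s) = flip (i + 2 * t) \<longleftrightarrow> int n dvd s - t" for s t
      using dvd_mult_cancel_left[of 2 "int n" "s - t"] by (simp add: algebra_simps)
  qed (use n_ge_2 in simp)
  ultimately show ?thesis by simp
qed

lemma hansen_vukicevic_CSCom: "hansen_vukicevic (CSCom G)"
  unfolding CSCom_def
proof (rule hansen_vukicevic_super_commuting_graph)
  show "equiv (carrier G) (conjugacy G)" by (rule equiv_conjugacy)
  show "y \<in> center" if x: "x \<in> center" and "(x, y) \<in> conjugacy G" for x y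
  proof -
    obtain i where i: "x = rot i" using x center_subset by auto
    then show ?thesis using that conjugacy_rot by fastforce
  qed
  show "y \<in> flips" if "x \<in> flips" "(x, y) \<in> conjugacy G" for x y
    using that by (auto simp: conjugacy_flip_iff intro: rangeI)
  fix x assume "x \<in> flips"
  then obtain i where i: "x = flip i" by auto
  have "{y \<in> flips. super_adjacent G (conjugacy G) x y} = {flip j | j. odd n \<or> even (i - j)}"
    unfolding i by (auto simp: super_adjacent_conjugacy_flips_iff simp del: flip_eq_iff)
  also have "card \<dots> = (if odd n then 2 * n else n)"
    using card_flips_same_parity[of i] card_flips by (simp add: full_SetCompr_eq)
  finally show "card {y \<in> flips. super_adjacent G (conjugacy G) x y} = (if odd n then 2 * n else n)" .
qed (use n_ge_2 in auto)

lemma ord_dvd_iff_squares: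
  assumes "x \<in> carrier G"
  shows "ord x dvd 2 \<longleftrightarrow> x \<otimes> x = \<one>" "ord x dvd 4 \<longleftrightarrow> (x \<otimes> x) \<otimes> (x \<otimes> x) = \<one>"
  using assms pow_eq_id[of x 2] pow_eq_id[of x 4]
  by (simp_all add: numeral_eq_Suc m_assoc)

lemma ord_eq_4:
  assumes "ord x dvd 4" "\<not> ord x dvd 2"
  shows "ord x = 4"
proof -
  have "ord x \<le> 4" using assms(1) by (rule dvd_imp_le) simp
  moreover have "ord x \<noteq> 0" "ord x \<noteq> 3" using assms(1) by (intro notI; simp)+
  moreover have "ord x \<noteq> 1" "ord x \<noteq> 2" using assms(2) by auto
  ultimately show ?thesis by linarith
qed

lemma ord_flip: "ord (flip i) = 4"
  using not_period_n by (intro ord_eq_4) (simp_all add: ord_dvd_iff_squares)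

lemma center_iff_ord:
  assumes "x \<in> carrier G"
  shows "x \<in> center \<longleftrightarrow> ord x dvd 2"
  using assms
proof (cases rule: range_cases)
  case (rot i)
  then show ?thesis using two_n_dvd_double_iff[of i] by (simp add: ord_dvd_iff_squares)
next
  case (flip i)
  then show ?thesis using ord_flip by simp
qed

lemma same_order_flips: "x \<in> flips \<Longrightarrow> y \<in> flips \<Longrightarrow> super_adjacent G (same_order G) x y"
  using ord_flip by (auto simp: super_adjacent_def same_order_def)

text \<open>If \<open>2 n\<close> divides \<open>4 i\<close> and \<open>n\<close> is odd, then \<open>n\<close> divides \<open>i\<close>; the rotation is then central, so its
  order divides 2.\<close>

lemma ord_rot_neq_4:
  assumes "odd n" shows "ord (rot i) \<noteq> 4"
proof
  assume ord: "ord (rot i) = 4"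
  then have "2 * int n dvd i + i + (i + i)" using ord_dvd_iff_squares(2)[of "rot i"] by simp
  then have "int n dvd 2 * i" using dvd_mult_cancel_left[of 2 "int n" "2 * i"] by simp
  moreover have "coprime (int n) 2" using assms by simp
  ultimately have "int n dvd i" by (simp add: coprime_dvd_mult_right_iff)
  then show False using ord center_iff_ord[of "rot i"] by simp
qed

lemma hansen_vukicevic_OSCom_odd:
  assumes "odd n" shows "hansen_vukicevic (OSCom G)"
  unfolding OSCom_def
proof (rule hansen_vukicevic_super_commuting_graph)
  show "equiv (carrier G) (same_order G)" by (rule equiv_same_order)
  show "y \<in> center" if "x \<in> center" "(x, y) \<in> same_order G" for x y
    using that by (auto simp: same_order_def center_iff_ord)
  show "y \<in> flips" if x: "x \<in> flips" and xy: "(x, y) \<in> same_order G" for x y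
  proof -
    have "y \<in> carrier G" "ord y = 4"
      using x xy ord_flip by (auto simp: same_order_def)
    then show ?thesis using ord_rot_neq_4[OF assms] carrier_cases by blast
  qed
  show "card {y \<in> flips. super_adjacent G (same_order G) x y} = 2 * n" if "x \<in> flips" for x
    using that same_order_flips card_flips by (simp add: Collect_conj_eq Int_absorb2 subsetI)
qed (use n_ge_2 in auto)

text \<open>The rotation with exponent \<open>n / 2\<close> has order 4, so it represents the class of every flip; it commutes
  with all rotations, which makes all rotations adjacent to all flips.\<close>

lemma hansen_vukicevic_OSCom_even:
  assumes "even n" shows "hansen_vukicevic (OSCom G)"
  unfolding OSCom_def
proof (rule hansen_vukicevic_complete[where g = \<one> and h = \<beta>])
  show "\<one> \<noteq> \<beta>" using \<beta>_not_rot[of 0] by simp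
  let ?adj = "super_adjacent G (same_order G)"
  from assms obtain h where h: "n = 2 * h" by blast
  have "ord (rot (int h)) dvd 4" "\<not> ord (rot (int h)) dvd 2"
    using not_period_n by (simp_all add: ord_dvd_iff_squares h)
  then have cls: "(flip j, rot (int h)) \<in> same_order G" for j
    using ord_eq_4[of "rot (int h)"] ord_flip by (simp add: same_order_def)
  have rot_refl: "(rot i, rot i) \<in> same_order G" for i by (simp add: same_order_def)
  have rot_flip_adj: "?adj (rot i) (flip j)" for i j
  proof -
    have "rot i \<otimes> rot (int h) = rot (int h) \<otimes> rot i" by (simp add: add.commute)
    then show ?thesis
      unfolding super_adjacent_def using cls[of j] rot_refl[of i] by blast
  qed
  have rot_rot_adj: "?adj (rot i) (rot j)" for i j
    by (rule super_adjacent_if_commute[OF equiv_same_order]) (simp_all add: add.commute)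
  fix x y assume "x \<in> carrier G" "y \<in> carrier G"
  then show "?adj x y"
    by (elim range_cases)
      (auto intro: rot_rot_adj rot_flip_adj same_order_flips super_adjacent_sym[OF rot_flip_adj])
qed (use finite_carrier in auto)

end

section \<open>The presented group\<close>

lemma presented_group_inverse:
  "inv\<^bsub>presented_group R\<^esub> (word_cong R `` {[Gen x]}) = word_cong R `` {[Inv x]}"
proof -
  interpret group "presented_group R" by (rule group_presented_group)
  have "word_cong R `` {[Inv x] @ [Gen x]} = word_cong R `` {[]}"
    by (intro equiv_class_eq[OF equiv_word_cong]) (simp add: word_cong.cancel_left)
  then show ?thesis
    by (intro inv_equality) (simp_all add: presented_group_mult, auto simp: presented_group_def quotient_def)
qed

lemma presented_group_pow:
  "word_cong R `` {[Gen x]} [^]\<^bsub>presented_group R\<^esub> (k :: nat) = word_cong R `` {replicate k (Gen x)}"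
proof (induction k)
  case 0
  then show ?case by (simp add: presented_group_def)
next
  case (Suc k)
  then show ?case by (simp add: presented_group_mult replicate_append_same)
qed

text \<open>The pair \<open>(i, e)\<close> encodes the normal form \<open>\<alpha>\<^sup>i \<beta>\<^sup>e\<close>, and a letter acts as left multiplication would:
  \<open>\<beta>\<close> changes the sign of the exponent, and \<open>\<beta> \<beta> = \<alpha>\<^sup>n\<close> contributes \<open>n\<close>.\<close>

fun letter_action :: "int \<Rightarrow> quaternion_gen letter \<Rightarrow> int \<times> bool \<Rightarrow> int \<times> bool" where
  "letter_action n (Gen quaternion_gen.a) (i, e) = ((i + 1) mod (2 * n), e)"
| "letter_action n (Inv quaternion_gen.a) (i, e) = ((i - 1) mod (2 * n), e)"
| "letter_action n (Gen quaternion_gen.b) (i, e) = ((if e then n - i else - i) mod (2 * n), \<not> e)"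
| "letter_action n (Inv quaternion_gen.b) (i, e) = ((if e then - i else n - i) mod (2 * n), \<not> e)"

definition word_action :: "int \<Rightarrow> quaternion_gen letter list \<Rightarrow> int \<times> bool \<Rightarrow> int \<times> bool" where
  "word_action n u = foldr (letter_action n) u"

lemma word_action_simps [simp]:
  "word_action n [] x = x"
  "word_action n (l # u) x = letter_action n l (word_action n u x)"
  "word_action n (u @ v) x = word_action n u (word_action n v x)"
  by (simp_all add: word_action_def)

text \<open>Exponents enter the actions only through their residue, so states can be taken of the form
  \<open>(i mod (2 * n), e)\<close> throughout; on other states the formal inverses fail to cancel.\<close>

lemma letter_action_mod:
  "letter_action n l (i mod (2 * n), e) = letter_action n l (i, e)"
  by (cases "(n, l, i, e)" rule: letter_action.cases) (auto simp: mod_simps)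

lemma word_action_replicate_a:
  "word_action n (replicate k (Gen quaternion_gen.a)) (i mod (2 * n), e) = ((i + int k) mod (2 * n), e)"
  by (induction k) (simp_all add: mod_simps algebra_simps)

lemma word_action_mod: "\<exists>j f. word_action n u (i mod (2 * n), e) = (j mod (2 * n), f)"
proof (induction u)
  case (Cons l u)
  then obtain j f where "word_action n u (i mod (2 * n), e) = (j mod (2 * n), f)" by blast
  then show ?case
    by (cases "(n, l, j, f)" rule: letter_action.cases) (auto simp: letter_action_mod)
qed auto

text \<open>The action respects cancellation and the defining relations, hence factors through the presented
  group. Two words that move the state \<open>(0, False)\<close> differently therefore represent different
  elements.\<close>

lemma word_action_cong:
  assumes "(u, v) \<in> word_cong (quaternion_relations n)"
  shows "word_action n u (i mod (2 * int n), e) = word_action n v (i mod (2 * int n), e)"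
  using assms
proof (induction arbitrary: i e)
  case (append u u' v v')
  obtain j f where "word_action n v (i mod (2 * int n), e) = (j mod (2 * int n), f)"
    using word_action_mod by blast
  then show ?case using append.IH by (metis word_action_simps(3))
next
  case (cancel_right x)
  show ?case by (cases x; cases e) (simp_all add: mod_simps letter_action_mod)
next
  case (cancel_left x)
  show ?case by (cases x; cases e) (simp_all add: mod_simps letter_action_mod)
next
  case (relation u v)
  then consider "u = replicate (2 * n) (Gen quaternion_gen.a)" "v = []"
    | "u = replicate n (Gen quaternion_gen.a)" "v = [Gen quaternion_gen.b, Gen quaternion_gen.b]"
    | "u = [Gen quaternion_gen.b, Gen quaternion_gen.a, Inv quaternion_gen.b]" "v = [Inv quaternion_gen.a]"
    by (auto simp: quaternion_relations_def)
  then show ?case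
  proof cases
    case 1
    then show ?thesis by (simp only: word_action_replicate_a) simp
  next
    case 2
    have "(i + int n) mod (2 * int n) = (i - int n) mod (2 * int n)"
      by (simp add: mod_eq_dvd_iff)
    with 2 show ?thesis
      by (simp only: word_action_replicate_a)
        (cases e; simp add: mod_simps letter_action_mod algebra_simps)
  next
    case 3
    then show ?thesis by (cases e) (simp_all add: mod_simps letter_action_mod algebra_simps)
  qed
qed simp_all

text \<open>Left multiplication by a letter keeps an element in normal form, which gives the list of elements.
  Normal forms are separated by the action: \<open>\<alpha>\<^sup>k\<close> sends \<open>(0, False)\<close> to \<open>(k mod (2 * n), False)\<close>, while
  \<open>\<beta>\<close> changes the second component.\<close>

lemma quaternion_elements_quaternion_group:
  assumes "2 \<le> n"
  defines "R \<equiv> quaternion_relations n"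
  shows "quaternion_elements (quaternion_group n) n
    (word_cong R `` {[Gen quaternion_gen.a]}) (word_cong R `` {[Gen quaternion_gen.b]})"
proof -
  let ?a = "quaternion_gen.a" and ?b = "quaternion_gen.b"
  define cls where "cls u = word_cong R `` {u}" for u
  define Q where "Q = quaternion_group n"
  have Q: "Q = presented_group R" by (simp add: Q_def quaternion_group_def R_def)
  have carrier: "x \<in> carrier Q \<longleftrightarrow> (\<exists>u. x = cls u)" for x
    by (auto simp: Q presented_group_def quotient_def cls_def)
  have mult: "cls u \<otimes>\<^bsub>Q\<^esub> cls v = cls (u @ v)" for u v
    by (simp add: Q cls_def presented_group_mult)
  have one: "\<one>\<^bsub>Q\<^esub> = cls []" by (simp add: Q cls_def presented_group_def)
  have inv: "inv\<^bsub>Q\<^esub> (cls [Gen x]) = cls [Inv x]" for x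
    unfolding Q cls_def by (rule presented_group_inverse)
  have pow: "cls [Gen x] [^]\<^bsub>Q\<^esub> (k :: nat) = cls (replicate k (Gen x))" for x k
    unfolding Q cls_def by (rule presented_group_pow)
  have rel: "cls u = cls v" if "(u, v) \<in> R" for u v
    unfolding cls_def by (intro equiv_class_eq[OF equiv_word_cong] word_cong.relation that)
  have act: "word_action n u (0, False) = word_action n v (0, False)" if "cls u = cls v" for u v
  proof -
    have "(u, v) \<in> word_cong (quaternion_relations n)"
      using eq_equiv_class[OF that[unfolded cls_def] equiv_word_cong] by (simp add: R_def)
    from word_action_cong[OF this, of 0 False] show ?thesis by simp
  qed
  interpret group Q unfolding Q by (rule group_presented_group)
  interpret quaternion_generators Q n "cls [Gen ?a]" "cls [Gen ?b]"
  proof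
    show "cls [Gen ?a] \<in> carrier Q" "cls [Gen ?b] \<in> carrier Q" using carrier by blast+
    show "cls [Gen ?a] [^]\<^bsub>Q\<^esub> (2 * n) = \<one>\<^bsub>Q\<^esub>"
      unfolding pow one by (rule rel) (simp add: R_def quaternion_relations_def)
    show "cls [Gen ?a] [^]\<^bsub>Q\<^esub> n = cls [Gen ?b] \<otimes>\<^bsub>Q\<^esub> cls [Gen ?b]"
      unfolding pow mult by (rule rel) (simp add: R_def quaternion_relations_def)
    show "cls [Gen ?b] \<otimes>\<^bsub>Q\<^esub> cls [Gen ?a] \<otimes>\<^bsub>Q\<^esub> inv\<^bsub>Q\<^esub> (cls [Gen ?b]) = inv\<^bsub>Q\<^esub> (cls [Gen ?a])"
      unfolding inv mult by (rule rel) (simp add: R_def quaternion_relations_def)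
  qed (use assms in simp)
  have rot_nat: "\<exists>k. rot i = cls (replicate k (Gen ?a)) \<and> int k = i mod (2 * int n)" for i
  proof -
    define k where "k = nat (i mod (2 * int n))"
    have k: "int k = i mod (2 * int n)" using assms(1) by (simp add: k_def)
    have "rot i = rot (i mod (2 * int n) + 2 * int n * (i div (2 * int n)))" by simp
    also have "\<dots> = rot (i mod (2 * int n)) \<otimes>\<^bsub>Q\<^esub> rot (2 * int n * (i div (2 * int n)))"
      by (simp only: rot_rot)
    also have "\<dots> = rot (int k)"
      by (simp add: k rot_eq_one)
    also have "\<dots> = cls (replicate k (Gen ?a))"
      by (simp add: rot_def int_pow_int pow)
    finally show ?thesis using k by blast
  qed
  have a_rot: "cls [Gen ?a] = rot 1" "cls [Inv ?a] = rot (- 1)"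
    by (simp_all add: rot_def int_pow_neg inv)
  have b_flip: "cls [Gen ?b] = flip 0" "cls [Inv ?b] = flip n"
  proof -
    show "cls [Gen ?b] = flip 0" by (simp add: flip_def)
    then have "cls [Inv ?b] = inv\<^bsub>Q\<^esub> (flip 0)" by (simp flip: inv)
    then show "cls [Inv ?b] = flip n" by simp
  qed
  have "quaternion_elements Q n (cls [Gen ?a]) (cls [Gen ?b])"
  proof
    fix x assume "x \<in> carrier Q"
    then obtain u where "x = cls u" using carrier by blast
    moreover have "cls u \<in> range rot \<union> range flip"
    proof (induction u)
      case Nil
      have "cls [] = rot 0" by (simp flip: one)
      then show ?case by blast
    next
      case (Cons l u)
      have "cls (l # u) = cls [l] \<otimes>\<^bsub>Q\<^esub> cls u" by (simp add: mult)
      moreover have "cls [l] \<in> range rot \<union> range flip"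
      proof -
        have "cls [Gen ?a] \<in> range rot" "cls [Inv ?a] \<in> range rot"
          "cls [Gen ?b] \<in> range flip" "cls [Inv ?b] \<in> range flip"
          by (rule range_eqI, rule a_rot b_flip)+
        then have "cls [Gen x] \<in> range rot \<union> range flip \<and> cls [Inv x] \<in> range rot \<union> range flip"
          for x by (cases x) blast+
        then show ?thesis by (cases l) blast+
      qed
      ultimately show ?case using Cons by auto
    qed
    ultimately show "x \<in> range rot \<union> range flip" by simp
  next
    fix i assume i: "rot i = \<one>\<^bsub>Q\<^esub>"
    obtain k where k: "rot i = cls (replicate k (Gen ?a))" "int k = i mod (2 * int n)"
      using rot_nat by blast
    then have "word_action n (replicate k (Gen ?a)) (0, False) = (0, False)"
      using act[of "replicate k (Gen ?a)" "[]"] i by (simp add: one)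
    then have "int k mod (2 * int n) = 0"
      using word_action_replicate_a[of "int n" k 0 False] by simp
    then show "2 * int n dvd i" by (simp add: k mod_eq_0_iff_dvd)
  next
    fix i show "cls [Gen ?b] \<noteq> rot i"
    proof
      assume b: "cls [Gen ?b] = rot i"
      obtain k where k: "rot i = cls (replicate k (Gen ?a))" using rot_nat by blast
      have "word_action n [Gen ?b] (0, False) = word_action n (replicate k (Gen ?a)) (0, False)"
        by (rule act[OF HOL.trans[OF b k]])
      then show False using word_action_replicate_a[of "int n" k 0 False] by simp
    qed
  qed
  then show ?thesis by (simp add: cls_def Q_def)
qed

theorem theorem3p3:
  fixes n :: nat
  assumes "n \<ge> 2"
    and "\<Gamma> \<in> {ESCom (quaternion_group n), CSCom (quaternion_group n), OSCom (quaternion_group n)}"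
  shows "real (zagreb2 \<Gamma>) / real (card (edges \<Gamma>)) \<ge> real (zagreb1 \<Gamma>) / real (card (verts \<Gamma>))"
proof -
  interpret quaternion_elements "quaternion_group n" n
    "word_cong (quaternion_relations n) `` {[Gen quaternion_gen.a]}"
    "word_cong (quaternion_relations n) `` {[Gen quaternion_gen.b]}"
    using assms(1) by (rule quaternion_elements_quaternion_group)
  have "hansen_vukicevic \<Gamma>"
    using assms(2) hansen_vukicevic_ESCom hansen_vukicevic_CSCom
      hansen_vukicevic_OSCom_odd hansen_vukicevic_OSCom_even by blast
  then show ?thesis by (simp add: hansen_vukicevic_def)
qed

end
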